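(* Let $m=(m(p))_{p\ge0}$ be a sequence of positive real numbers with $m(0)=1$, let $n\ge1$ be an integer, and put $\lambda_n^H:=\frac{2m(n)}{m(n-1)}$. Then the moment differential equation $$\partial_m^2y(x)-2x\,\partial_my(x)+\lambda_n^H\,y(x)=0$$ has a polynomial solution $y_{H,m}$ of degree $n$, given by $$y_{H,m}(x)=\sum_{p=0}^n\frac{a_p}{m(p)}x^p,$$ where: (1) If $n$ is even, then $a_0\neq0$ is an arbitrary constant, $a_{2k-1}=0$ for $1\le k\le n/2$, $a_2=-\lambda_n^Ha_0$, and for $k\ge2$ (with $2k\le n$) $$a_{2k}=-m(2k)\frac{\lambda_n^Ha_0}{m(2)}\prod_{j=1}^{k-1}\left(\frac{m(2j)\left[\frac{2m(2j)}{m(2j-1)}-\lambda_n^H\right]}{m(2j+2)}\right).$$ (2) If $n$ is odd, then $a_1\neq0$ is an arbitrary constant, $a_{2k}=0$ for $0\le k\le\lfloor n/2\rfloor$, and for $k\ge1$ (with $2k+1\le n$) $$a_{2k+1}=m(2k+1)\frac{a_1}{m(1)}\prod_{j=0}^{k-1}\left(\frac{m(2j+1)\left[\frac{2m(2j+1)}{m(2j)}-\lambda_n^H\right]}{m(2j+3)}\right).$$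
   Context: For a sequence $m=(m(p))_{p\ge0}$ of positive reals, the moment derivative $\partial_m:\mathbb{C}[[x]]\to\mathbb{C}[[x]]$ is defined by $\partial_m\left(\sum_{p\ge0}\frac{a_p}{m(p)}x^p\right)=\sum_{p\ge0}\frac{a_{p+1}}{m(p)}x^p$; equivalently $\partial_m1=0$ and $\partial_mx^p=\frac{m(p)}{m(p-1)}x^{p-1}$ for $p\ge1$. $\partial_m^2=\partial_m\circ\partial_m$.
   Formalization: "Of degree n" fails for some m (m(p)=1 for all p, n=4 gives a_4=0); the theorem instead proves degree at most n, with equality exactly when 2m(p)/m(p-1) differs from λ_n^H for all 1≤p<n of the same parity as n. *)

theory Defs
  imports Complex_Main "HOL-Computational_Algebra.Computational_Algebra"
begin

(* If f is written as the sum of a_p / m(p) x^p, then a_p = m(p) * fps_nth f p, so the p-th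
   coefficient below is a_(p+1) / m(p); see moment_deriv_eq. *)
definition moment_deriv :: "(nat \<Rightarrow> real) \<Rightarrow> complex fps \<Rightarrow> complex fps" where
  "moment_deriv m f =
     Abs_fps (\<lambda>p. of_real (m (Suc p)) * fps_nth f (Suc p) / of_real (m p))"

lemma moment_deriv_eq:
  assumes "\<And>p. m p > 0"
  shows "moment_deriv m (Abs_fps (\<lambda>p. a p / of_real (m p))) =
           Abs_fps (\<lambda>p. a (Suc p) / of_real (m p))"
proof -
  have "m p \<noteq> 0" for p using assms[of p] by simp
  then show ?thesis by (simp add: moment_deriv_def fps_eq_iff)
qed

(* Only used for n >= 1; truncated subtraction makes the value at n = 0 meaningless. *)
definition hermite_ev :: "(nat \<Rightarrow> real) \<Rightarrow> nat \<Rightarrow> real" where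
  "hermite_ev m n = 2 * m n / m (n - 1)"

definition moment_hermite_eq :: "(nat \<Rightarrow> real) \<Rightarrow> nat \<Rightarrow> complex fps \<Rightarrow> bool" where
  "moment_hermite_eq m n y \<longleftrightarrow>
     (moment_deriv m ^^ 2) y - 2 * fps_X * moment_deriv m y
       + fps_const (of_real (hermite_ev m n)) * y = 0"

end

theory Submission
  imports Defs
begin

text \<open>For y the sum of a_p / m(p) x^p the equation says a_2 = - \<lambda> a_0 and
  a_(p+2) = (\<mu>_p - \<lambda>) a_p for p \<ge> 1, where \<mu>_p = 2 m(p) / m(p - 1) and \<lambda> = \<mu>_n; setting
  \<mu>_0 = 0 unifies the two. Hence a_p is the initial value times the product of the factors
  \<mu>_q - \<lambda> over the q < p of the parity of n. The factor with q = n vanishes, so the series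
  stops at degree n, and the coefficient of x^n vanishes precisely if an earlier factor does.
  The quotients of moments in the stated formulas telescope.\<close>

text \<open>For positive m these are the eigenvalues of \<open>2 * fps_X * moment_deriv m\<close> on
  the powers of x. Constants are killed, so index 0 gets 0; truncated subtraction would give
  \<open>hermite_ev m 0\<close> the value 2.\<close>

definition hermite_mu :: "(nat \<Rightarrow> real) \<Rightarrow> nat \<Rightarrow> real" where
  "hermite_mu m p = (if p = 0 then 0 else hermite_ev m p)"

text \<open>The product is empty at p = 0 for even n and at p = 1 for odd n, so \<open>c\<close> is
  the free initial value in both cases.\<close>

definition hermite_coeff :: "(nat \<Rightarrow> real) \<Rightarrow> nat \<Rightarrow> complex \<Rightarrow> nat \<Rightarrow> complex" where
  "hermite_coeff m n c p =
     (if even p = even n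
      then c * of_real (\<Prod>q | q < p \<and> even q = even n. hermite_mu m q - hermite_ev m n)
      else 0)"

lemma hermite_ev_pos:
  assumes "\<And>p. m p > 0"
  shows "hermite_ev m n > 0"
  using assms by (simp add: hermite_ev_def)

lemma hermite_coeff_rec:
  "hermite_coeff m n c (p + 2) =
     hermite_coeff m n c p * of_real (hermite_mu m p - hermite_ev m n)"
proof (cases "even p = even n")
  case True
  \<comment> \<open>The index p + 1 has the wrong parity, so only p is new.\<close>
  then have "{q. q < p + 2 \<and> even q = even n} = insert p {q. q < p \<and> even q = even n}"
    by (auto simp: less_Suc_eq)
  with True show ?thesis
    by (simp add: hermite_coeff_def)
qed (simp add: hermite_coeff_def)

lemma hermite_coeff_eq_0_iff:
  assumes "c \<noteq> 0" "even p = even n"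
  shows "hermite_coeff m n c p = 0 \<longleftrightarrow>
    (\<exists>q<p. even q = even n \<and> hermite_mu m q = hermite_ev m n)"
  using assms by (auto simp: hermite_coeff_def)

lemma hermite_coeff_eq_0:
  assumes "n \<ge> 1" "p > n"
  shows "hermite_coeff m n c p = 0"
proof (cases "even p = even n")
  case True
  \<comment> \<open>The factor at q = n is zero because \<open>n \<ge> 1\<close>; for n = 0 the two
    values would differ.\<close>
  have "\<exists>q<p. even q = even n \<and> hermite_mu m q = hermite_ev m n"
    using assms by (intro exI[of _ n]) (simp add: hermite_mu_def)
  with True show ?thesis
    by (auto simp: hermite_coeff_def)
qed (simp add: hermite_coeff_def)

text \<open>Comparing coefficients of x^p gives a_(p+2) / m(p) - 2 a_p / m(p - 1) + \<lambda> a_p /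
  m(p) = 0, with the middle term absent at p = 0; multiplying by m(p) turns this into
  \<open>rec\<close>.\<close>

lemma moment_hermite_eqI:
  assumes pos: "\<And>p. m p > 0"
    and rec: "\<And>p. a (p + 2) = a p * of_real (hermite_mu m p - hermite_ev m n)"
  shows "moment_hermite_eq m n (Abs_fps (\<lambda>p. a p / of_real (m p)))"
proof -
  have nz: "m p \<noteq> 0" for p
    using pos[of p] by simp
  have d2: "(moment_deriv m ^^ 2) (Abs_fps (\<lambda>p. a p / of_real (m p))) =
      Abs_fps (\<lambda>p. a (Suc (Suc p)) / of_real (m p))"
    by (simp add: numeral_2_eq_2 moment_deriv_eq[OF pos])
  show ?thesis
    unfolding moment_hermite_eq_def
  proof (rule fps_ext)
    fix p
    show "fps_nth ((moment_deriv m ^^ 2) (Abs_fps (\<lambda>p. a p / of_real (m p)))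
        - 2 * fps_X * moment_deriv m (Abs_fps (\<lambda>p. a p / of_real (m p)))
        + fps_const (of_real (hermite_ev m n)) * Abs_fps (\<lambda>p. a p / of_real (m p))) p = fps_nth 0 p"
      using rec[of p] nz[of p] nz[of "p - 1"]
      by (cases "p = 0") (simp_all add: d2 moment_deriv_eq[OF pos] numeral_fps_const mult.assoc
          hermite_mu_def hermite_ev_def[of m p] field_simps)
  qed
qed

lemma hermite_poly:
  assumes pos: "\<And>p. m p > 0" and n: "n \<ge> 1" and c: "c \<noteq> 0"
    and y: "y = (\<Sum>p = 0..n. monom (hermite_coeff m n c p / of_real (m p)) p)"
  shows "moment_hermite_eq m n (fps_of_poly y)"
    and "degree y \<le> n"
    and "degree y = n \<longleftrightarrow>
      (\<forall>p. 1 \<le> p \<and> p < n \<and> even p = even n \<longrightarrow> hermite_ev m p \<noteq> hermite_ev m n)"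
proof -
  \<comment> \<open>Beyond n the coefficients are zero anyway, so cutting off the sum loses nothing
    of the series.\<close>
  have coeff: "coeff y p = hermite_coeff m n c p / of_real (m p)" for p
    using n by (cases "p \<le> n") (auto simp: y coeff_sum hermite_coeff_eq_0)
  have "fps_of_poly y = Abs_fps (\<lambda>p. hermite_coeff m n c p / of_real (m p))"
    by (simp add: fps_eq_iff coeff)
  then show "moment_hermite_eq m n (fps_of_poly y)"
    using moment_hermite_eqI[where m = m and a = "hermite_coeff m n c", OF pos hermite_coeff_rec] by simp
  show deg: "degree y \<le> n"
    using n by (intro degree_le) (simp add: coeff hermite_coeff_eq_0)
  \<comment> \<open>The zero polynomial has degree 0, which \<open>n \<ge> 1\<close> keeps apart
    from n.\<close>
  have "degree y = n \<longleftrightarrow> coeff y n \<noteq> 0"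
    using deg n by (metis coeff_0 degree_0 le_degree le_antisym leading_coeff_0_iff
        not_one_le_zero)
  also have "\<dots> \<longleftrightarrow> hermite_coeff m n c n \<noteq> 0"
    using pos[of n] by (simp add: coeff)
  also have "\<dots> \<longleftrightarrow>
      (\<forall>p. 1 \<le> p \<and> p < n \<and> even p = even n \<longrightarrow> hermite_ev m p \<noteq> hermite_ev m n)"
    \<comment> \<open>As \<lambda> > 0 = \<mu>_0, the factor at q = 0 never vanishes, so only
      indices p \<ge> 1 matter.\<close>
    using hermite_ev_pos[of m n, OF pos]
    by (auto simp: hermite_coeff_eq_0_iff[OF c] hermite_mu_def Suc_le_eq)
  finally show "degree y = n \<longleftrightarrow>
      (\<forall>p. 1 \<le> p \<and> p < n \<and> even p = even n \<longrightarrow> hermite_ev m p \<noteq> hermite_ev m n)" .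
qed

text \<open>The quotients \<open>f j / f (Suc j)\<close> multiply to \<open>f s / f k\<close>, which
  cancels the prefactors and leaves \<open>b s\<close> times the product of the
  \<open>g j\<close>.\<close>

lemma linear_recurrence_telescope:
  fixes b :: "nat \<Rightarrow> complex" and f g :: "nat \<Rightarrow> real"
  assumes rec: "\<And>j. j \<ge> s \<Longrightarrow> b (Suc j) = b j * of_real (g j)"
    and nz: "\<And>j. f j \<noteq> 0" and "s \<le> k"
  shows "b k = of_real (f k) * (b s / of_real (f s)) *
    of_real (\<Prod>j = s..<k. f j * g j / f (Suc j))"
  using \<open>s \<le> k\<close>
proof (induction k rule: dec_induct)
  case (step k)
  with nz show ?case
    by (simp add: rec prod.atLeastLessThan_Suc)
qed (simp add: nz)

text \<open>The degree is settled by a criterion because it can drop below n: for m constantly 1 and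
  n = 3 every \<open>hermite_ev m p\<close> is 2, so a_3 = 0 and the solution has degree 1.\<close>

theorem proposition2:
  fixes m :: "nat \<Rightarrow> real" and n :: nat
  assumes pos: "\<And>p. m p > 0" and m0: "m 0 = 1" and n: "n \<ge> 1"
  shows
    "(even n \<longrightarrow>
       (\<forall>c :: complex. c \<noteq> 0 \<longrightarrow>
         (\<exists>(a :: nat \<Rightarrow> complex) (y :: complex poly).
            a 0 = c \<and>
            (\<forall>k. 1 \<le> k \<and> k \<le> n div 2 \<longrightarrow> a (2 * k - 1) = 0) \<and>
            a 2 = - of_real (hermite_ev m n) * a 0 \<and>
            (\<forall>k. 2 \<le> k \<and> 2 * k \<le> n \<longrightarrow>
               a (2 * k) = - of_real (m (2 * k)) * (of_real (hermite_ev m n) * a 0 / of_real (m 2)) *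
                 of_real (\<Prod>j = 1..k - 1.
                   m (2 * j) * (2 * m (2 * j) / m (2 * j - 1) - hermite_ev m n) / m (2 * j + 2))) \<and>
            y = (\<Sum>p = 0..n. monom (a p / of_real (m p)) p) \<and>
            moment_hermite_eq m n (fps_of_poly y) \<and>
            degree y \<le> n \<and>
            (degree y = n \<longleftrightarrow>
              (\<forall>p. 1 \<le> p \<and> p < n \<and> even p \<longrightarrow> hermite_ev m p \<noteq> hermite_ev m n))))) \<and>
     (odd n \<longrightarrow>
       (\<forall>c :: complex. c \<noteq> 0 \<longrightarrow>
         (\<exists>(a :: nat \<Rightarrow> complex) (y :: complex poly).
            a 1 = c \<and>
            (\<forall>k. k \<le> n div 2 \<longrightarrow> a (2 * k) = 0) \<and>
            (\<forall>k. 1 \<le> k \<and> 2 * k + 1 \<le> n \<longrightarrow>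
               a (2 * k + 1) = of_real (m (2 * k + 1)) * (a 1 / of_real (m 1)) *
                 of_real (\<Prod>j = 0..k - 1.
                   m (2 * j + 1) * (2 * m (2 * j + 1) / m (2 * j) - hermite_ev m n) / m (2 * j + 3))) \<and>
            y = (\<Sum>p = 0..n. monom (a p / of_real (m p)) p) \<and>
            moment_hermite_eq m n (fps_of_poly y) \<and>
            degree y \<le> n \<and>
            (degree y = n \<longleftrightarrow>
              (\<forall>p. 1 \<le> p \<and> p < n \<and> odd p \<longrightarrow> hermite_ev m p \<noteq> hermite_ev m n)))))"
proof -
  have nz: "m p \<noteq> 0" for p
    using pos[of p] by simp
  have rec: "hermite_coeff m n c (Suc (Suc p)) =
      hermite_coeff m n c p * of_real (hermite_mu m p - hermite_ev m n)" for c p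
    using hermite_coeff_rec[of m n c p] by simp
  have pred: "{s..k - Suc 0} = {s..<k}" if "k \<ge> 1" for s k :: nat
    using that by auto
  show ?thesis
  proof (intro conjI impI allI, goal_cases)
    case (1 c)
    define a where "a = hermite_coeff m n c"
    have a0: "a 0 = c"
      using 1 by (simp add: a_def hermite_coeff_def)
    have a2: "a 2 = - of_real (hermite_ev m n) * a 0"
      using rec[of c 0] by (simp add: a_def hermite_mu_def numeral_2_eq_2)
    have odd0: "a (2 * k - 1) = 0" if "1 \<le> k" for k
      using 1 that by (simp add: a_def hermite_coeff_def)
    have closed: "a (2 * k) =
        - of_real (m (2 * k)) * (of_real (hermite_ev m n) * a 0 / of_real (m 2)) *
          of_real (\<Prod>j = 1..k - 1.
            m (2 * j) * (2 * m (2 * j) / m (2 * j - 1) - hermite_ev m n) / m (2 * j + 2))"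
      if "2 \<le> k" for k
    proof -
      \<comment> \<open>The start is j = 1: the factor for j = 0 is \<open>- hermite_ev m n\<close>,
        not of the general shape, and is already contained in a_2.\<close>
      have "a (2 * k) = of_real (m (2 * k)) * (a (2 * 1) / of_real (m (2 * 1))) *
          of_real (\<Prod>j = 1..<k.
            m (2 * j) * (2 * m (2 * j) / m (2 * j - 1) - hermite_ev m n) / m (2 * Suc j))"
        using that
        by (intro linear_recurrence_telescope[where b = "\<lambda>k. a (2 * k)" and f = "\<lambda>k. m (2 * k)"])
           (simp_all add: a_def rec nz hermite_mu_def hermite_ev_def[of m "2 * _"])
      with that show ?thesis
        by (simp add: pred a2)
    qed
    show ?case
      using a0 a2 odd0 closed hermite_poly[OF pos n 1(2) refl] 1(1)
      by (intro exI[of _ a] exI conjI, unfold a_def) simp_all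
  next
    case (2 c)
    define a where "a = hermite_coeff m n c"
    have empty: "{q :: nat. q = 0 \<and> odd q} = {}"
      by (auto intro: odd_pos)
    have a1: "a 1 = c"
      using 2 by (simp add: a_def hermite_coeff_def empty)
    have even0: "a (2 * k) = 0" for k
      using 2 by (simp add: a_def hermite_coeff_def)
    have closed: "a (2 * k + 1) =
        of_real (m (2 * k + 1)) * (a 1 / of_real (m 1)) *
          of_real (\<Prod>j = 0..k - 1.
            m (2 * j + 1) * (2 * m (2 * j + 1) / m (2 * j) - hermite_ev m n) / m (2 * j + 3))"
      if "1 \<le> k" for k
    proof -
      \<comment> \<open>Odd indices never meet \<mu>_0, so this product can start at j = 0.\<close>
      have "a (2 * k + 1) = of_real (m (2 * k + 1)) * (a (2 * 0 + 1) / of_real (m (2 * 0 + 1))) *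
          of_real (\<Prod>j = 0..<k.
            m (2 * j + 1) * (2 * m (2 * j + 1) / m (2 * j) - hermite_ev m n) / m (2 * Suc j + 1))"
        by (intro linear_recurrence_telescope[where b = "\<lambda>k. a (2 * k + 1)"
              and f = "\<lambda>k. m (2 * k + 1)"])
           (simp_all add: a_def rec nz hermite_mu_def hermite_ev_def[of m "Suc _"])
      with that show ?thesis
        by (simp add: pred numeral_3_eq_3)
    qed
    show ?case
      using a1 even0 closed hermite_poly[OF pos n 2(2) refl] 2(1)
      by (intro exI[of _ a] exI conjI, unfold a_def) simp_all
  qed
qed

end
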